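(* Let $m,i,k$ be positive integers and let $$\mathbb{M}_{k}^{(m,i)}=\sum_{j=0}^{\infty}\frac{(-1)^{j}}{(mj+i)^{k}}.$$ Then $$\mathbb{M}_{k}^{(m,i)}=\sum_{n=0}^{\infty}\frac{n!}{2^{n+1}\,m\,(i/m)_{n+1}}\,B_{n,k-1}^{(m,i)},$$ where the numbers $B_{n,k}^{(m,i)}$ are defined by $B_{n,0}^{(m,i)}=1$ for all $n\ge0$ and $B_{n,k}^{(m,i)}=\sum_{j=0}^{n}\frac{1}{mj+i}B_{j,k-1}^{(m,i)}$ for $n\ge0$, $k\ge1$.
   Context: $(a)_n=a(a+1)\cdots(a+n-1)$ denotes the rising factorial. *)

theory Defs
  imports Complex_Main
begin

definition altM_term :: "nat \<Rightarrow> nat \<Rightarrow> nat \<Rightarrow> nat \<Rightarrow> real" where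
  "altM_term m i k j = (-1) ^ j / real (m * j + i) ^ k"

definition altM :: "nat \<Rightarrow> nat \<Rightarrow> nat \<Rightarrow> real" where
  "altM m i k = (\<Sum>j. altM_term m i k j)"

text \<open>The argument order is \<open>numB m i n k\<close> for $B_{n,k}^{(m,i)}$; recursion is on the second
  lower index \<open>k\<close>.\<close>

fun numB :: "nat \<Rightarrow> nat \<Rightarrow> nat \<Rightarrow> nat \<Rightarrow> real" where
  "numB m i n 0 = 1"
| "numB m i n (Suc k) = (\<Sum>j=0..n. 1 / real (m * j + i) * numB m i j k)"

end

theory Submission
  imports Defs "HOL-Real_Asymp.Real_Asymp"
begin

text \<open>
  Euler's transformation \<open>\<Sum>b\<^sub>j = \<Sum>\<^sub>n 2\<^sup>-\<^sup>n\<^sup>-\<^sup>1 \<Sum>\<^sub>j (n choose j) b\<^sub>j\<close> preserves the sum of a convergent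
  series, because its partial sums are binomial means of the original ones. For
  \<open>b\<^sub>j = (-1)\<^sup>j / (mj+i)\<^sup>k\<close> the inner sum \<open>D(n,k)\<close> satisfies
  \<open>(mn+i) D(n,k) = mn D(n-1,k) + D(n,k-1)\<close>, since \<open>n ((n-1) choose j) = (n-j) (n choose j)\<close>.
  The closed form in terms of \<open>B\<^sub>n\<^sub>,\<^sub>k\<^sub>-\<^sub>1\<close> obeys the same recurrence.
\<close>

section \<open>Regularity of binomial means\<close>

lemma binomial_over_two_power_tendsto_0:
  "(\<lambda>n. real (n choose j) / 2 ^ n) \<longlonglongrightarrow> 0"
proof (rule tendsto_sandwich[of "\<lambda>_. 0"])
  show "\<forall>\<^sub>F n in sequentially. real (n choose j) / 2 ^ n \<le> real n ^ j / 2 ^ n"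
  proof (intro always_eventually allI)
    fix n
    have "n choose j \<le> n ^ j"
      by (cases "j \<le> n") (auto intro: binomial_le_pow simp: binomial_eq_0 not_le)
    then have "real (n choose j) \<le> real n ^ j"
      by (metis of_nat_le_iff of_nat_power)
    then show "real (n choose j) / 2 ^ n \<le> real n ^ j / 2 ^ n"
      by (simp add: divide_right_mono)
  qed
  show "(\<lambda>n. real n ^ j / 2 ^ n) \<longlonglongrightarrow> 0"
    by real_asymp
qed auto

text \<open>These are the means of Euler's (E,1) summation method: the expectation of
  \<open>s\<close> under the binomial distribution with parameters \<open>n\<close> and 1/2.\<close>

definition binomial_mean :: "(nat \<Rightarrow> real) \<Rightarrow> nat \<Rightarrow> real" where
  "binomial_mean s n = (\<Sum>j\<le>n. real (n choose j) * s j) / 2 ^ n"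

lemma sum_binomial_real: "(\<Sum>j\<le>n. real (n choose j)) = 2 ^ n"
  using choose_row_sum[of n] by (metis of_nat_numeral of_nat_power of_nat_sum)

text \<open>The weights are nonnegative with total 1, so the tail, where \<open>s\<close> is small,
  contributes little; the head has boundedly many indices, and each of their weights tends to
  0.\<close>

lemma binomial_mean_tendsto_0:
  assumes "s \<longlonglongrightarrow> 0"
  shows "binomial_mean s \<longlonglongrightarrow> 0"
proof (rule LIMSEQ_I)
  fix e :: real
  assume "e > 0"
  then obtain J where J: "\<And>j. j \<ge> J \<Longrightarrow> \<bar>s j\<bar> < e / 2"
    using LIMSEQ_D[OF assms, of "e / 2"] by auto
  have "(\<lambda>n. \<Sum>j<J. real (n choose j) / 2 ^ n * \<bar>s j\<bar>) \<longlonglongrightarrow> 0"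
    by (intro tendsto_null_sum tendsto_mult_left_zero binomial_over_two_power_tendsto_0)
  then obtain N where N: "\<And>n. n \<ge> N \<Longrightarrow> \<bar>\<Sum>j<J. real (n choose j) / 2 ^ n * \<bar>s j\<bar>\<bar> < e / 2"
    using LIMSEQ_D[of _ 0 "e / 2"] \<open>e > 0\<close> by fastforce
  show "\<exists>N. \<forall>n\<ge>N. norm (binomial_mean s n - 0) < e"
  proof (intro exI allI impI)
    fix n
    assume "n \<ge> N"
    let ?c = "\<lambda>j. real (n choose j) / 2 ^ n"
    have "\<bar>binomial_mean s n\<bar> = \<bar>\<Sum>j\<le>n. ?c j * s j\<bar>"
      by (simp add: binomial_mean_def sum_divide_distrib)
    also have "\<dots> \<le> (\<Sum>j\<le>n. ?c j * \<bar>s j\<bar>)"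
      by (rule order_trans[OF sum_abs]) (simp add: abs_mult)
    \<comment> \<open>Charging \<open>e / 2\<close> to the head indices as well makes the first part
      sum over the full row, hence to exactly \<open>e / 2\<close>.\<close>
    also have "\<dots> \<le> (\<Sum>j\<le>n. ?c j * (e / 2) + (if j < J then ?c j * \<bar>s j\<bar> else 0))"
    proof (rule sum_mono)
      fix j
      show "?c j * \<bar>s j\<bar> \<le> ?c j * (e / 2) + (if j < J then ?c j * \<bar>s j\<bar> else 0)"
        using J[of j] \<open>e > 0\<close> mult_left_mono[of "\<bar>s j\<bar>" "e / 2" "?c j"] by (cases "j < J") auto
    qed
    also have "\<dots> = e / 2 + (\<Sum>j\<in>{..n} \<inter> {..<J}. ?c j * \<bar>s j\<bar>)"
    proof -
      have "(\<Sum>j\<le>n. ?c j * (e / 2)) = e / 2"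
        by (simp add: sum_binomial_real flip: sum_distrib_right sum_divide_distrib)
      then show ?thesis
        by (simp only: sum.distrib sum.inter_restrict finite_atMost lessThan_iff)
    qed
    also have "(\<Sum>j\<in>{..n} \<inter> {..<J}. ?c j * \<bar>s j\<bar>) \<le> (\<Sum>j<J. ?c j * \<bar>s j\<bar>)"
      by (rule sum_mono2) auto
    also have "\<dots> < e / 2"
      using N[OF \<open>n \<ge> N\<close>] by linarith
    finally show "norm (binomial_mean s n - 0) < e"
      by simp
  qed
qed

lemma binomial_mean_diff_const: "binomial_mean (\<lambda>j. s j - c) n = binomial_mean s n - c"
proof -
  have "(\<Sum>j\<le>n. real (n choose j) * c) = 2 ^ n * c"
    by (simp add: sum_binomial_real flip: sum_distrib_right)
  then show ?thesis
    by (simp add: binomial_mean_def right_diff_distrib sum_subtractf diff_divide_distrib)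
qed

lemma binomial_mean_tendsto:
  assumes "s \<longlonglongrightarrow> c"
  shows "binomial_mean s \<longlonglongrightarrow> c"
proof -
  have "binomial_mean (\<lambda>j. s j - c) \<longlonglongrightarrow> 0"
    using assms by (intro binomial_mean_tendsto_0) (simp add: LIM_zero_iff)
  then show ?thesis
    by (simp add: binomial_mean_diff_const[abs_def] LIM_zero_iff)
qed

section \<open>Euler's series transformation\<close>

text \<open>Pascal's rule splits row \<open>Suc n\<close> into two copies of row \<open>n\<close>,
  one of them shifted by one.\<close>

lemma sum_binomial_Suc:
  fixes s :: "nat \<Rightarrow> real"
  shows "(\<Sum>j\<le>Suc n. real (Suc n choose j) * s j) = (\<Sum>j\<le>n. real (n choose j) * (s j + s (Suc j)))"
proof -
  have "(\<Sum>j\<le>Suc n. real (Suc n choose j) * s j)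
      = s 0 + (\<Sum>j\<le>n. real (Suc n choose Suc j) * s (Suc j))"
    by (subst sum.atMost_Suc_shift) simp
  also have "\<dots> = s 0 + (\<Sum>j\<le>n. real (n choose Suc j) * s (Suc j)) + (\<Sum>j\<le>n. real (n choose j) * s (Suc j))"
    by (simp add: distrib_right sum.distrib)
  also have "s 0 + (\<Sum>j\<le>n. real (n choose Suc j) * s (Suc j)) = (\<Sum>j\<le>Suc n. real (n choose j) * s j)"
    by (subst sum.atMost_Suc_shift) simp
  finally show ?thesis
    by (simp add: distrib_left sum.distrib)
qed

text \<open>For partial sums \<open>s\<close>, \<open>s j + s (Suc j) = 2 * s j + b j\<close>:
  passing to the next row keeps the old mean and adds one transformed term. The strict bound
  \<open>l < j\<close> makes both sides 0 at \<open>N = 0\<close>.\<close>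

lemma binomial_mean_partial_sums:
  "binomial_mean (\<lambda>j. \<Sum>l<j. b l) N = (\<Sum>n<N. (\<Sum>j\<le>n. real (n choose j) * b j) / 2 ^ Suc n)"
proof (induction N)
  case 0
  show ?case
    by (simp add: binomial_mean_def)
next
  case (Suc N)
  let ?s = "\<lambda>j. \<Sum>l<j. b l"
  have "binomial_mean ?s (Suc N) = (\<Sum>j\<le>N. real (N choose j) * (2 * ?s j + b j)) / 2 ^ Suc N"
    unfolding binomial_mean_def sum_binomial_Suc by (simp add: algebra_simps)
  also have "\<dots> = binomial_mean ?s N + (\<Sum>j\<le>N. real (N choose j) * b j) / 2 ^ Suc N"
    by (simp add: binomial_mean_def distrib_left sum.distrib add_divide_distrib mult.left_commute
        flip: sum_distrib_left)
  finally show ?case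
    using Suc.IH by simp
qed

lemma Euler_transform_sums:
  fixes b :: "nat \<Rightarrow> real"
  assumes "b sums S"
  shows "(\<lambda>n. (\<Sum>j\<le>n. real (n choose j) * b j) / 2 ^ Suc n) sums S"
  using binomial_mean_tendsto[OF assms[unfolded sums_def]]
  unfolding sums_def binomial_mean_partial_sums .

section \<open>Closed form of the transformed terms\<close>

text \<open>Termwise, split \<open>m * Suc n + i\<close> as \<open>m * (Suc n - j)\<close> plus
  \<open>m * j + i\<close>: the first part lowers the binomial row, the second cancels one factor of
  the denominator.\<close>

lemma binomial_sum_altM_term_Suc:
  assumes "i \<ge> 1"
  shows "real (m * Suc n + i) * (\<Sum>j\<le>Suc n. real (Suc n choose j) * altM_term m i (Suc k) j)
       = real (m * Suc n) * (\<Sum>j\<le>n. real (n choose j) * altM_term m i (Suc k) j)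
         + (\<Sum>j\<le>Suc n. real (Suc n choose j) * altM_term m i k j)"
proof -
  have absorb: "real (Suc n) * real (n choose j) = (real (Suc n) - real j) * real (Suc n choose j)"
    if "j \<le> Suc n" for j
  proof -
    have "Suc n * (n choose j) = (Suc n - j) * (Suc n choose j)"
      using binomial_absorb_comp[of "Suc n" j] by simp
    then show ?thesis
      using that by (metis of_nat_diff of_nat_mult)
  qed
  have cancel: "real (m * j + i) * altM_term m i (Suc k) j = altM_term m i k j" for j
  proof -
    have "real (m * j + i) \<noteq> 0"
      using assms by (simp only: of_nat_eq_0_iff)
    then show ?thesis
      by (simp add: altM_term_def del: of_nat_add of_nat_mult of_nat_eq_0_iff)
  qed
  have "real (m * Suc n + i) * (real (Suc n choose j) * altM_term m i (Suc k) j)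
      = real (m * Suc n) * (real (n choose j) * altM_term m i (Suc k) j)
        + real (Suc n choose j) * altM_term m i k j" if "j \<le> Suc n" for j
  proof -
    have "real (m * Suc n) * real (n choose j) = real m * (real (Suc n) - real j) * real (Suc n choose j)"
      using absorb[OF that] by (simp only: of_nat_mult mult.assoc)
    then show ?thesis
      unfolding cancel[of j, symmetric] by (simp only: mult.assoc[symmetric]) (simp add: algebra_simps)
  qed
  then have "(\<Sum>j\<le>Suc n. real (m * Suc n + i) * (real (Suc n choose j) * altM_term m i (Suc k) j))
      = (\<Sum>j\<le>Suc n. real (m * Suc n) * (real (n choose j) * altM_term m i (Suc k) j)
        + real (Suc n choose j) * altM_term m i k j)"
    by (intro sum.cong refl) (simp del: of_nat_Suc of_nat_mult of_nat_add)
  then have "real (m * Suc n + i) * (\<Sum>j\<le>Suc n. real (Suc n choose j) * altM_term m i (Suc k) j)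
       = real (m * Suc n) * (\<Sum>j\<le>Suc n. real (n choose j) * altM_term m i (Suc k) j)
         + (\<Sum>j\<le>Suc n. real (Suc n choose j) * altM_term m i k j)"
    by (simp only: sum_distrib_left sum.distrib)
  \<comment> \<open>The extra index \<open>Suc n\<close> contributes nothing, as
    \<open>n choose Suc n\<close> is 0.\<close>
  also have "(\<Sum>j\<le>Suc n. real (n choose j) * altM_term m i (Suc k) j)
      = (\<Sum>j\<le>n. real (n choose j) * altM_term m i (Suc k) j)"
    by simp
  finally show ?thesis .
qed

text \<open>This is the expansion of \<open>(1 - 1) ^ n\<close>. Its vanishing for positive
  \<open>n\<close> makes the recurrence for exponent 1 homogeneous.\<close>

lemma binomial_sum_altM_term_0:
  "(\<Sum>j\<le>n. real (n choose j) * altM_term m i 0 j) = (if n = 0 then 1 else 0)"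
  using choose_alternating_sum[of n, where 'a = real]
  by (auto simp: altM_term_def mult.commute)

lemma binomial_sum_altM_term:
  assumes "m \<ge> 1" and "i \<ge> 1"
  shows "(\<Sum>j\<le>n. real (n choose j) * altM_term m i (Suc k) j)
       = fact n / (real m * pochhammer (real i / real m) (Suc n)) * numB m i n k"
proof -
  \<comment> \<open>\<open>c n\<close> is the value of the sum for exponent 1, a Beta integral;
    \<open>c_0\<close> and \<open>c_Suc\<close> are the homogeneous recurrence that determines
    it.\<close>
  define c where "c n = fact n / (real m * pochhammer (real i / real m) (Suc n))" for n
  have c_0: "real i * c 0 = 1"
    using assms by (simp add: c_def)
  have c_Suc: "real (m * Suc n + i) * c (Suc n) = real (m * Suc n) * c n" for n
  proof -
    have "real (m * Suc n + i) = real m * (real i / real m + real (Suc n))"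
      using assms(1) by (simp add: field_simps)
    moreover have "real i / real m + real (Suc n) > 0"
      by (intro add_nonneg_pos) auto
    moreover have "pochhammer (real i / real m) (Suc n) > 0"
      using assms by (intro pochhammer_pos) simp
    ultimately show ?thesis
      using assms(1)
      by (simp add: c_def pochhammer_Suc[of _ "Suc n"] del: of_nat_Suc of_nat_add)
        (simp add: field_simps)
  qed
  have pos: "real (m * n + i) > 0" for n
    using assms(2) by (simp only: of_nat_0_less_iff)
  have "(\<Sum>j\<le>n. real (n choose j) * altM_term m i (Suc k) j) = c n * numB m i n k"
  proof (induction k arbitrary: n)
    case 0
    show ?case
    proof (induction n)
      case 0
      show ?case
        using c_0 assms by (simp add: altM_term_def field_simps)
    next
      case (Suc n)
      have "real (m * Suc n + i) * (\<Sum>j\<le>Suc n. real (Suc n choose j) * altM_term m i (Suc 0) j)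
          = real (m * Suc n + i) * c (Suc n)"
        unfolding binomial_sum_altM_term_Suc[OF assms(2)] Suc.IH binomial_sum_altM_term_0 c_Suc
        by simp
      then show ?case
        using pos[of "Suc n"] by (simp only: mult_cancel_left numB.simps) simp
    qed
  next
    case IH_k: (Suc k)
    show ?case
    proof (induction n)
      case 0
      show ?case
        using IH_k[of 0] assms by (simp add: altM_term_def field_simps)
    next
      case (Suc n)
      \<comment> \<open>The last summand of the recursion for \<open>numB\<close>, once multiplied
        by \<open>m * Suc n + i\<close>, matches the inhomogeneous term of the recurrence, which the
        outer induction hypothesis gives as \<open>c (Suc n) * numB m i (Suc n) k\<close>.\<close>
      have B: "numB m i (Suc n) (Suc k)
          = numB m i n (Suc k) + numB m i (Suc n) k / real (m * Suc n + i)"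
        by (simp del: of_nat_add of_nat_mult of_nat_Suc)
      have "real (m * Suc n + i) * (\<Sum>j\<le>Suc n. real (Suc n choose j) * altM_term m i (Suc (Suc k)) j)
          = real (m * Suc n + i) * c (Suc n) * numB m i n (Suc k) + c (Suc n) * numB m i (Suc n) k"
        unfolding binomial_sum_altM_term_Suc[OF assms(2)] Suc.IH IH_k c_Suc by (simp only: mult.assoc)
      also have "\<dots> = real (m * Suc n + i) * (c (Suc n) * numB m i (Suc n) (Suc k))"
        unfolding B using pos[of "Suc n"]
        by (simp add: distrib_left del: of_nat_add of_nat_mult of_nat_Suc numB.simps mult_Suc_right)
      finally show ?case
        using pos[of "Suc n"] by (simp only: mult_cancel_left) simp
    qed
  qed
  then show ?thesis
    by (simp only: c_def)
qed

section \<open>Convergence and conclusion\<close>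

text \<open>Leibniz's criterion applies for every positive \<open>k\<close>, including
  \<open>k = 1\<close>, where convergence is only conditional.\<close>

lemma altM_term_sums_altM:
  assumes "m \<ge> 1" and "i \<ge> 1" and "k \<ge> 1"
  shows "altM_term m i k sums altM m i k"
proof -
  let ?a = "\<lambda>j. 1 / real (m * j + i) ^ k"
  have "real j \<le> real (m * j + i) ^ k" for j
  proof -
    have "j \<le> m * j + i"
      using assms(1) by (simp add: trans_le_add1)
    also have "\<dots> \<le> (m * j + i) ^ k"
      using assms by (simp add: self_le_power)
    finally show ?thesis
      by (metis of_nat_le_iff of_nat_power)
  qed
  then have "\<forall>\<^sub>F j in sequentially. ?a j \<le> 1 / real j"
    \<comment> \<open>The bound starts at 1: at \<open>j = 0\<close> the right side is
      \<open>1 / 0 = 0\<close>.\<close>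
    by (intro eventually_sequentiallyI[of 1] frac_le) auto
  then have "?a \<longlonglongrightarrow> 0"
    by (intro tendsto_sandwich[of "\<lambda>_. 0", OF _ _ tendsto_const lim_1_over_n]) auto
  moreover have "?a (Suc j) \<le> ?a j" for j
    using assms by (intro frac_le power_mono zero_less_power) (auto simp: add_nonneg_pos)
  then have "monoseq ?a"
    by (blast intro: mono_SucI2)
  ultimately have "summable (\<lambda>j. (-1) ^ j * ?a j)"
    by (rule summable_Leibniz)
  then show ?thesis
    by (simp add: altM_def altM_term_def[abs_def] summable_sums)
qed

theorem theorem1:
  fixes m i k :: nat
  assumes "m \<ge> 1" and "i \<ge> 1" and "k \<ge> 1"
  shows "summable (altM_term m i k) \<and>
    (\<lambda>n. fact n / (2 ^ (n + 1) * real m * pochhammer (real i / real m) (n + 1))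
          * numB m i n (k - 1)) sums altM m i k"
proof
  note sums = altM_term_sums_altM[OF assms]
  then show "summable (altM_term m i k)"
    by (rule sums_summable)
  \<comment> \<open>The closed form is stated for exponent \<open>Suc k\<close>, so it is
    instantiated at \<open>k - 1\<close>.\<close>
  have "Suc (k - 1) = k"
    using assms(3) by simp
  then show "(\<lambda>n. fact n / (2 ^ (n + 1) * real m * pochhammer (real i / real m) (n + 1))
          * numB m i n (k - 1)) sums altM m i k"
    using Euler_transform_sums[OF sums] binomial_sum_altM_term[OF assms(1,2), of _ "k - 1"]
    by (simp add: mult_ac)
qed

end
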